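(* For $n\ge 1$ let $A_n(x,y,q)=\sum_{\pi\in\mathfrak{S}_n}x^{\mathrm{exc}(\pi)}y^{\mathrm{fix}(\pi)}q^{\mathrm{cyc}(\pi)}$ and $A(x,y,q;z)=1+\sum_{n\ge1}A_n(x,y,q)\frac{z^n}{n!}$. For $n\ge 0$ let $\widetilde{A}_n(x,y,q,p)=\sum_{\sigma\in\widehat{\mathcal{Q}}_{n+1}}x^{\mathrm{exc}(\sigma)}y^{\mathrm{fix}(\sigma)}q^{\mathrm{cyc}(\sigma)}p^{\mathrm{fcyc}(\sigma)}$ and $\widetilde{A}(x,y,q,p;z)=\sum_{n\ge0}\widetilde{A}_n(x,y,q,p)\frac{z^n}{n!}$. Then, as formal power series in $z$, $$\widetilde{A}(x,y,q,p;z)=\left(e^{xpz}+y-1\right)pq\,A(x,y,q;z).$$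
   Context: For $\sigma\in\mathfrak{S}_m$: $\mathrm{exc}(\sigma)=|\{i:\sigma(i)>i\}|$, $\mathrm{fix}(\sigma)=|\{i:\sigma(i)=i\}|$, $\mathrm{cyc}(\sigma)$ is the number of cycles. $\widehat{\mathcal{Q}}_m$ is the set of $\sigma\in\mathfrak{S}_m$ whose cycle containing $m$, written as $(c_1,\dots,c_k,m)$ ending with $m$ (i.e. $\sigma(c_i)=c_{i+1}$, $\sigma(c_k)=m$, $\sigma(m)=c_1$), satisfies $c_1<c_2<\cdots<c_k$ (possibly $k=0$, i.e. $m$ is a fixed point); $\mathrm{fcyc}(\sigma)$ is the number of elements of the cycle containing $m$. *)

theory Defs
  imports
    "HOL-Combinatorics.Orbits"
    "HOL-Computational_Algebra.Formal_Power_Series"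
begin

text \<open>
  Permutations of \<open>{1..m}\<close> are functions \<open>\<sigma> :: nat \<Rightarrow> nat\<close> with \<open>\<sigma> permutes {1..m}\<close>; these fix
  every number outside \<open>{1..m}\<close>, so each statistic takes \<open>m\<close> as a parameter.
\<close>

definition perm_exc :: "nat \<Rightarrow> (nat \<Rightarrow> nat) \<Rightarrow> nat" where
  "perm_exc m \<sigma> = card {i \<in> {1..m}. \<sigma> i > i}"

definition perm_fix :: "nat \<Rightarrow> (nat \<Rightarrow> nat) \<Rightarrow> nat" where
  "perm_fix m \<sigma> = card {i \<in> {1..m}. \<sigma> i = i}"

text \<open>Fixed points count as cycles of length one.\<close>

definition perm_cyc :: "nat \<Rightarrow> (nat \<Rightarrow> nat) \<Rightarrow> nat" where
  "perm_cyc m \<sigma> = card (orbit \<sigma> ` {1..m})"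

definition perm_fcyc :: "nat \<Rightarrow> (nat \<Rightarrow> nat) \<Rightarrow> nat" where
  "perm_fcyc m \<sigma> = card (orbit \<sigma> m)"

definition is_cycle_word :: "(nat \<Rightarrow> nat) \<Rightarrow> nat list \<Rightarrow> bool" where
  "is_cycle_word \<sigma> ws \<longleftrightarrow>
     ws \<noteq> [] \<and> distinct ws \<and>
     (\<forall>i < length ws. \<sigma> (ws ! i) = ws ! (Suc i mod length ws))"

definition Q_hat :: "nat \<Rightarrow> (nat \<Rightarrow> nat) set" where
  "Q_hat m = {\<sigma>. \<sigma> permutes {1..m} \<and>
     (\<exists>cs. is_cycle_word \<sigma> (cs @ [m]) \<and> sorted_wrt (<) cs)}"

definition A_poly :: "nat \<Rightarrow> 'a::field_char_0 \<Rightarrow> 'a \<Rightarrow> 'a \<Rightarrow> 'a" where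
  "A_poly n x y q =
     (\<Sum>\<pi> | \<pi> permutes {1..n}. x ^ perm_exc n \<pi> * y ^ perm_fix n \<pi> * q ^ perm_cyc n \<pi>)"

definition A_series :: "'a::field_char_0 \<Rightarrow> 'a \<Rightarrow> 'a \<Rightarrow> 'a fps" where
  "A_series x y q = 1 + Abs_fps (\<lambda>n. if n \<ge> 1 then A_poly n x y q / fact n else 0)"

definition A_tilde_poly :: "nat \<Rightarrow> 'a::field_char_0 \<Rightarrow> 'a \<Rightarrow> 'a \<Rightarrow> 'a \<Rightarrow> 'a" where
  "A_tilde_poly n x y q p =
     (\<Sum>\<sigma> \<in> Q_hat (n + 1). x ^ perm_exc (n + 1) \<sigma> * y ^ perm_fix (n + 1) \<sigma>
        * q ^ perm_cyc (n + 1) \<sigma> * p ^ perm_fcyc (n + 1) \<sigma>)"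

definition A_tilde_series :: "'a::field_char_0 \<Rightarrow> 'a \<Rightarrow> 'a \<Rightarrow> 'a \<Rightarrow> 'a fps" where
  "A_tilde_series x y q p = Abs_fps (\<lambda>n. A_tilde_poly n x y q p / fact n)"

end

theory Submission
  imports Defs "HOL-Combinatorics.Cycles" "HOL-Library.Infinite_Set"
begin

text \<open>
  A permutation in \<open>Q_hat (n + 1)\<close> is determined by the set \<open>S \<subseteq> {1..n}\<close> of the other elements in
  the cycle of \<open>n + 1\<close> and by an arbitrary permutation of \<open>{1..n} - S\<close>. Since the cycle word
  increases up to \<open>n + 1\<close>, every element of \<open>S\<close> is an excedance, so the cycle contributes
  \<open>p q (x p)^k\<close> with \<open>k = card S\<close>, times \<open>y\<close> if \<open>k = 0\<close>; relabelling \<open>{1..n} - S\<close> in order, the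
  rest contributes \<open>A_poly (n - k)\<close>. Hence \<open>A_tilde_poly n\<close> is a binomial convolution, which is the
  product of the two exponential generating functions.
\<close>

section \<open>Weights of permutations of a finite set and order-preserving relabelling\<close>

definition perm_weight :: "'a::comm_semiring_1 \<Rightarrow> 'a \<Rightarrow> 'a \<Rightarrow> nat set \<Rightarrow> (nat \<Rightarrow> nat) \<Rightarrow> 'a" where
  "perm_weight x y q T \<pi> =
     x ^ card {i \<in> T. \<pi> i > i} * y ^ card {i \<in> T. \<pi> i = i} * q ^ card (orbit \<pi> ` T)"

definition perm_sum :: "'a::comm_semiring_1 \<Rightarrow> 'a \<Rightarrow> 'a \<Rightarrow> nat set \<Rightarrow> 'a" where
  "perm_sum x y q T = (\<Sum>\<pi> | \<pi> permutes T. perm_weight x y q T \<pi>)"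

lemma A_poly_eq_perm_sum: "A_poly n x y q = perm_sum x y q {1..n}"
  by (simp add: A_poly_def perm_sum_def perm_weight_def perm_exc_def perm_fix_def perm_cyc_def)

text \<open>Orbits of points of \<open>T\<close> never leave \<open>T\<close> when
  \<open>\<pi>\<close> maps \<open>T\<close> into itself, so values outside \<open>T\<close> do not
  affect the cycle count. This lets a permutation of \<open>{1..n+1}\<close> be compared with its
  restriction to \<open>T\<close>.\<close>

lemma perm_weight_cong:
  assumes "\<And>i. i \<in> T \<Longrightarrow> \<pi> i \<in> T" "\<And>i. i \<in> T \<Longrightarrow> \<pi> i = \<rho> i"
  shows "perm_weight x y q T \<pi> = perm_weight x y q T \<rho>"
proof -
  have "{i \<in> T. \<pi> i > i} = {i \<in> T. \<rho> i > i}" "{i \<in> T. \<pi> i = i} = {i \<in> T. \<rho> i = i}"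
    using assms(2) by auto
  moreover have "orbit \<pi> ` T = orbit \<rho> ` T"
    using assms by (intro image_cong refl orbit_cong0[where A = T]) auto
  ultimately show ?thesis
    by (simp add: perm_weight_def)
qed

text \<open>An increasing \<open>h\<close> preserves the comparisons of \<open>i\<close> with
  \<open>\<pi> i\<close>, and conjugation carries orbits to orbits. Since \<open>h\<close> is
  injective, distinct orbits have distinct images, so the number of cycles survives as well.\<close>

lemma perm_weight_conjugate:
  assumes h: "bij_betw h M N" "strict_mono_on M h" and fin: "finite M" and \<pi>: "\<pi> permutes M"
    and \<rho>: "\<And>i. i \<in> M \<Longrightarrow> \<rho> (h i) = h (\<pi> i)"
  shows "perm_weight x y q N \<rho> = perm_weight x y q M \<pi>"
proof -
  have inj: "inj_on h M" and N: "N = h ` M"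
    using h(1) by (auto simp: bij_betw_def)
  have in_M: "\<pi> i \<in> M" if "i \<in> M" for i
    using that \<pi> by (simp add: permutes_in_image)
  have less: "h i < h j \<longleftrightarrow> i < j" if "i \<in> M" "j \<in> M" for i j
    using that h(2) by (simp add: strict_mono_on_less)
  have eq: "h i = h j \<longleftrightarrow> i = j" if "i \<in> M" "j \<in> M" for i j
    using that inj by (simp add: inj_on_eq_iff)
  have "{i \<in> N. \<rho> i > i} = h ` {i \<in> M. \<pi> i > i}"
    by (auto simp: N \<rho> less in_M)
  then have exc: "card {i \<in> N. \<rho> i > i} = card {i \<in> M. \<pi> i > i}"
    using inj by (simp add: card_image inj_on_subset)
  have "{i \<in> N. \<rho> i = i} = h ` {i \<in> M. \<pi> i = i}"
    by (auto simp: N \<rho> eq in_M)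
  then have fixed: "card {i \<in> N. \<rho> i = i} = card {i \<in> M. \<pi> i = i}"
    using inj by (simp add: card_image inj_on_subset)
  have sub: "orbit \<pi> i \<subseteq> M" if "i \<in> M" for i
    using permutes_orbit_subset[OF \<pi> that] .
  have orb: "orbit \<rho> (h i) = h ` orbit \<pi> i" if "i \<in> M" for i
  proof -
    have "i \<in> orbit \<pi> i"
      using \<pi> fin by (intro permutation_self_in_orbit) (auto simp: permutation_permutes)
    then show ?thesis
      using sub[OF that] \<rho> by (intro orbit_inverse[symmetric]) auto
  qed
  have "orbit \<rho> ` N = image h ` (orbit \<pi> ` M)"
    unfolding N image_image by (rule image_cong[OF refl]) (rule orb)
  moreover have "inj_on (image h) (orbit \<pi> ` M)"
    using sub by (intro inj_on_subset[OF inj_on_image_Pow[OF inj]]) auto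
  ultimately have "card (orbit \<rho> ` N) = card (orbit \<pi> ` M)"
    by (simp add: card_image)
  with exc fixed show ?thesis
    by (simp add: perm_weight_def)
qed

lemma perm_sum_strict_mono:
  assumes h: "bij_betw h M N" "strict_mono_on M h" and fin: "finite M"
  shows "perm_sum x y q M = perm_sum x y q N"
proof -
  \<comment> \<open>The conjugate of \<open>\<pi>\<close> by \<open>h\<close>, extended by the
    identity outside \<open>N\<close> so that it permutes \<open>N\<close>.\<close>
  let ?conj = "\<lambda>\<pi> i. if i \<in> N then h (\<pi> (inv_into M h i)) else i"
  have "perm_weight x y q M \<pi> = perm_weight x y q N (?conj \<pi>)" if "\<pi> permutes M" for \<pi>
    using h(1) bij_betw_inv_into_left[OF h(1)]
    by (intro perm_weight_conjugate[symmetric, OF h fin that]) (auto simp: bij_betw_def)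
  then have "perm_sum x y q M = (\<Sum>\<pi> | \<pi> permutes M. perm_weight x y q N (?conj \<pi>))"
    unfolding perm_sum_def by (intro sum.cong) auto
  also have "\<dots> = perm_sum x y q N"
    unfolding perm_sum_def by (rule sum.reindex_bij_betw[OF bij_betw_permutations[OF h(1)]])
  finally show ?thesis .
qed

lemma perm_sum_eq_A_poly:
  assumes "finite T"
  shows "perm_sum x y q T = A_poly (card T) x y q"
proof -
  \<comment> \<open>The increasing enumeration starts at 0, so both \<open>T\<close> and
    \<open>{1..card T}\<close> are compared with \<open>{..<card T}\<close>.\<close>
  have *: "perm_sum x y q M = perm_sum x y q {..<card M}" if fin: "finite M" for M :: "nat set"
  proof -
    obtain h where "bij_betw h {..<card M} M" "strict_mono_on {..<card M} h"
      using ex_bij_betw_strict_mono_card[OF fin] .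
    then show ?thesis
      by (intro perm_sum_strict_mono[symmetric]) auto
  qed
  show ?thesis
    using *[OF assms] *[of "{1..card T}"] by (simp add: A_poly_eq_perm_sum)
qed

section \<open>Cycle words and the splitting of \<open>Q_hat\<close> by the cycle of the largest
  element\<close>

lemma is_cycle_word_imp_cyclic_on:
  assumes "is_cycle_word \<sigma> ws"
  shows "cyclic_on \<sigma> (set ws)"
proof -
  let ?l = "length ws"
  have l: "?l > 0" and step: "\<And>i. i < ?l \<Longrightarrow> \<sigma> (ws ! i) = ws ! (Suc i mod ?l)"
    using assms by (auto simp: is_cycle_word_def)
  \<comment> \<open>Iterating from the first letter walks through the word modulo its
    length.\<close>
  have pow: "(\<sigma> ^^ k) (ws ! 0) = ws ! (k mod ?l)" for k
    by (induction k) (use l in \<open>auto simp: step mod_Suc_eq\<close>)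
  have "orbit \<sigma> (ws ! 0) = set ws"
  proof (intro equalityI subsetI)
    fix a assume "a \<in> orbit \<sigma> (ws ! 0)"
    then show "a \<in> set ws"
      using l by (auto simp: orbit_altdef pow)
  next
    fix a assume "a \<in> set ws"
    then obtain j where j: "j < ?l" "a = ws ! j"
      by (auto simp: in_set_conv_nth)
    \<comment> \<open>An orbit consists of positive iterates only; adding a full turn
      \<open>?l\<close> makes the exponent positive even for \<open>j = 0\<close>.\<close>
    then have "a = (\<sigma> ^^ (j + ?l)) (ws ! 0)"
      by (simp add: pow)
    then show "a \<in> orbit \<sigma> (ws ! 0)"
      using l unfolding orbit_altdef by blast
  qed
  then show ?thesis
    using l by (intro cyclic_on_singleI[of "ws ! 0"]) simp_all
qed

lemma is_cycle_word_agree: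
  assumes "is_cycle_word \<sigma> ws" "is_cycle_word \<tau> ws" "a \<in> set ws"
  shows "\<sigma> a = \<tau> a"
  using assms by (auto simp: is_cycle_word_def in_set_conv_nth)

lemma is_cycle_word_cycle_of_list:
  assumes "ws \<noteq> []" "distinct ws"
  shows "is_cycle_word (cycle_of_list ws) ws"
proof -
  have "map (cycle_of_list ws) ws = rotate1 ws"
    using cyclic_rotation[OF assms(2), of 1] by simp
  then have "cycle_of_list ws (ws ! i) = ws ! (Suc i mod length ws)" if "i < length ws" for i
    using that by (metis nth_map nth_rotate1)
  then show ?thesis
    using assms by (simp add: is_cycle_word_def)
qed

text \<open>A set replaces the word bound by the quantifier in \<open>Q_hat\<close>: for finite
  \<open>S\<close>, sorting gives the only increasing word with letters \<open>S\<close>. For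
  infinite \<open>S\<close> the sorted list defaults to \<open>[]\<close>, hence the finiteness
  hypotheses below.\<close>

definition Q_hat_part :: "nat \<Rightarrow> nat set \<Rightarrow> (nat \<Rightarrow> nat) set" where
  "Q_hat_part m S = {\<sigma>. \<sigma> permutes {1..m} \<and> is_cycle_word \<sigma> (sorted_list_of_set S @ [m])}"

lemma Q_hat_part_orbit:
  assumes "\<sigma> \<in> Q_hat_part m S" "finite S"
  shows "cyclic_on \<sigma> (insert m S)" "orbit \<sigma> m = insert m S" "m \<notin> S"
proof -
  show "cyclic_on \<sigma> (insert m S)"
    using assms is_cycle_word_imp_cyclic_on[of \<sigma> "sorted_list_of_set S @ [m]"]
    by (simp add: Q_hat_part_def)
  then show "orbit \<sigma> m = insert m S"
    by (simp add: orbit_cyclic_eq3)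
  show "m \<notin> S"
    using assms by (simp add: Q_hat_part_def is_cycle_word_def)
qed

text \<open>A strictly increasing word is the sorted list of its letters. These lie in
  \<open>{1..n}\<close> because the orbit of \<open>Suc n\<close> stays in \<open>{1..Suc n}\<close>
  and distinctness excludes a second \<open>Suc n\<close>.\<close>

lemma Q_hat_eq_Union: "Q_hat (Suc n) = (\<Union>S\<in>Pow {1..n}. Q_hat_part (Suc n) S)"
proof (intro equalityI subsetI)
  fix \<sigma> assume "\<sigma> \<in> Q_hat (Suc n)"
  then obtain cs where \<sigma>: "\<sigma> permutes {1..Suc n}" and cs: "is_cycle_word \<sigma> (cs @ [Suc n])"
    "sorted_wrt (<) cs"
    by (auto simp: Q_hat_def)
  have "orbit \<sigma> (Suc n) = set (cs @ [Suc n])"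
    using is_cycle_word_imp_cyclic_on[OF cs(1)] by (intro orbit_cyclic_eq3) auto
  then have "set (cs @ [Suc n]) \<subseteq> {1..Suc n}"
    using permutes_orbit_subset[OF \<sigma>, of "Suc n"] by simp
  moreover have "Suc n \<notin> set cs"
    using cs(1) by (simp add: is_cycle_word_def)
  ultimately have "set cs \<subseteq> {1..n}"
    by (auto simp: subset_iff le_Suc_eq)
  moreover have "sorted_list_of_set (set cs) = cs"
    using cs(2) by (simp add: sorted_list_of_set.idem_if_sorted_distinct strict_sorted_iff)
  ultimately show "\<sigma> \<in> (\<Union>S\<in>Pow {1..n}. Q_hat_part (Suc n) S)"
    using \<sigma> cs(1) by (intro UN_I[of "set cs"]) (auto simp: Q_hat_part_def)
next
  fix \<sigma> assume "\<sigma> \<in> (\<Union>S\<in>Pow {1..n}. Q_hat_part (Suc n) S)"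
  then show "\<sigma> \<in> Q_hat (Suc n)"
    by (auto simp: Q_hat_def Q_hat_part_def)
qed

text \<open>The set \<open>S\<close> is recovered from \<open>\<sigma>\<close> as the orbit of
  \<open>Suc n\<close> without \<open>Suc n\<close>.\<close>

lemma Q_hat_part_disjoint:
  assumes "S \<subseteq> {1..n}" "S' \<subseteq> {1..n}" "S \<noteq> S'"
  shows "Q_hat_part (Suc n) S \<inter> Q_hat_part (Suc n) S' = {}"
proof -
  have False if "\<sigma> \<in> Q_hat_part (Suc n) S" "\<sigma> \<in> Q_hat_part (Suc n) S'" for \<sigma>
  proof -
    have fin: "finite S" "finite S'"
      using assms(1,2) finite_subset by blast+
    have "insert (Suc n) S = insert (Suc n) S'"
      using Q_hat_part_orbit(2) that fin by metis
    moreover have "Suc n \<notin> S" "Suc n \<notin> S'"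
      using assms(1,2) by auto
    ultimately show False
      using assms(3) by (simp add: insert_ident)
  qed
  then show ?thesis
    by blast
qed

section \<open>Statistics and weights on one piece of \<open>Q_hat\<close>\<close>

lemma Q_hat_part_values:
  assumes S: "S \<subseteq> {1..n}" and \<sigma>: "\<sigma> \<in> Q_hat_part (Suc n) S"
  shows "i \<in> S \<Longrightarrow> \<sigma> i > i" "\<sigma> (Suc n) = Suc n \<longleftrightarrow> S = {}" "\<sigma> (Suc n) \<le> Suc n"
proof -
  let ?ws = "sorted_list_of_set S @ [Suc n]"
  have fin: "finite S"
    using S finite_subset by blast
  have step: "\<sigma> (?ws ! i) = ?ws ! (Suc i mod length ?ws)" if "i < length ?ws" for i
    using \<sigma> that unfolding Q_hat_part_def is_cycle_word_def by blast
  \<comment> \<open>The final letter \<open>Suc n\<close> exceeds all of \<open>S\<close>, so even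
    the largest element of \<open>S\<close> is sent upwards.\<close>
  have sorted: "sorted_wrt (<) ?ws"
    using S fin by (auto simp: sorted_wrt_append)
  show "\<sigma> i > i" if i: "i \<in> S"
  proof -
    obtain j where j: "j < length (sorted_list_of_set S)" "sorted_list_of_set S ! j = i"
      using i fin by (metis in_set_conv_nth set_sorted_list_of_set)
    then have "?ws ! j = i" "\<sigma> (?ws ! j) = ?ws ! Suc j"
      using step[of j] by (auto simp: nth_append)
    then show ?thesis
      using sorted_wrt_nth_less[OF sorted, of j "Suc j"] j by simp
  qed
  have card1: "card (insert (Suc n) S) = 1 \<longleftrightarrow> S = {}"
    using fin Q_hat_part_orbit(3)[OF \<sigma> fin] by simp
  show "\<sigma> (Suc n) = Suc n \<longleftrightarrow> S = {}"
    using eq_on_cyclic_on_iff1[OF Q_hat_part_orbit(1)[OF \<sigma> fin], of "Suc n"] card1 by auto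
  show "\<sigma> (Suc n) \<le> Suc n"
    using \<sigma> permutes_in_image[of \<sigma> "{1..Suc n}" "Suc n"] by (simp add: Q_hat_part_def)
qed

lemma Q_hat_part_weight:
  fixes x y q p :: "'a::comm_semiring_1"
  assumes S: "S \<subseteq> {1..n}" and \<sigma>: "\<sigma> \<in> Q_hat_part (Suc n) S"
  shows "x ^ perm_exc (Suc n) \<sigma> * y ^ perm_fix (Suc n) \<sigma> * q ^ perm_cyc (Suc n) \<sigma>
           * p ^ perm_fcyc (Suc n) \<sigma>
    = (x * p) ^ card S * (if S = {} then y else 1) * (p * q) * perm_weight x y q ({1..n} - S) \<sigma>"
proof -
  let ?T = "{1..n} - S"
  have fin: "finite S"
    using S finite_subset by blast
  note val = Q_hat_part_values[OF S \<sigma>] and orb = Q_hat_part_orbit[OF \<sigma> fin]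
  have split: "{1..Suc n} = insert (Suc n) (S \<union> ?T)"
    using S by auto
  have cases: "i = Suc n \<or> i \<in> S \<or> i \<in> ?T" if "i \<in> {1..Suc n}" for i
    using that split by blast
  have gt: "\<forall>i\<in>S. \<sigma> i > i" and le: "\<not> \<sigma> (Suc n) > Suc n"
    using val(1,3) by (simp_all add: not_less)
  have "{i \<in> {1..Suc n}. \<sigma> i > i} = S \<union> {i \<in> ?T. \<sigma> i > i}"
  proof (intro equalityI subsetI)
    fix i assume "i \<in> {i \<in> {1..Suc n}. \<sigma> i > i}"
    then show "i \<in> S \<union> {i \<in> ?T. \<sigma> i > i}"
      using cases[of i] le by blast
  next
    fix i assume "i \<in> S \<union> {i \<in> ?T. \<sigma> i > i}"
    then show "i \<in> {i \<in> {1..Suc n}. \<sigma> i > i}"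
      using gt split by blast
  qed
  then have exc: "perm_exc (Suc n) \<sigma> = card S + card {i \<in> ?T. \<sigma> i > i}"
    unfolding perm_exc_def using fin by (simp, subst card_Un_disjoint) auto
  have "{i \<in> {1..Suc n}. \<sigma> i = i} = (if S = {} then {Suc n} else {}) \<union> {i \<in> ?T. \<sigma> i = i}"
  proof (intro equalityI subsetI)
    fix i assume "i \<in> {i \<in> {1..Suc n}. \<sigma> i = i}"
    then show "i \<in> (if S = {} then {Suc n} else {}) \<union> {i \<in> ?T. \<sigma> i = i}"
      using cases[of i] gt val(2) by (cases "i = Suc n") (use less_irrefl in fastforce)+
  next
    fix i assume "i \<in> (if S = {} then {Suc n} else {}) \<union> {i \<in> ?T. \<sigma> i = i}"
    then show "i \<in> {i \<in> {1..Suc n}. \<sigma> i = i}"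
      using val(2) by (cases "S = {}") auto
  qed
  then have fixed: "perm_fix (Suc n) \<sigma> = (if S = {} then 1 else 0) + card {i \<in> ?T. \<sigma> i = i}"
    unfolding perm_fix_def by simp
  have "orbit \<sigma> i = insert (Suc n) S" if "i \<in> insert (Suc n) S" for i
    using orbit_cyclic_eq3[OF orb(1) that] .
  then have "orbit \<sigma> ` {1..Suc n} = insert (insert (Suc n) S) (orbit \<sigma> ` ?T)"
    unfolding split by auto
  \<comment> \<open>Each \<open>i\<close> in \<open>?T\<close> lies in its own orbit but not in the
    cycle of \<open>Suc n\<close>, so that cycle adds exactly one to the count.\<close>
  moreover have "insert (Suc n) S \<notin> orbit \<sigma> ` ?T"
  proof
    assume "insert (Suc n) S \<in> orbit \<sigma> ` ?T"
    then obtain i where i: "i \<in> ?T" "orbit \<sigma> i = insert (Suc n) S"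
      by auto
    have "i \<in> orbit \<sigma> i"
      using \<sigma> by (intro permutation_self_in_orbit) (auto simp: permutation_permutes Q_hat_part_def)
    with i show False
      by auto
  qed
  ultimately have cyc: "perm_cyc (Suc n) \<sigma> = Suc (card (orbit \<sigma> ` ?T))"
    unfolding perm_cyc_def by simp
  \<comment> \<open>Here \<open>Suc n\<close> is counted along with \<open>S\<close>, which produces
    the factor \<open>p\<close> beyond \<open>p ^ card S\<close>.\<close>
  have fcyc: "perm_fcyc (Suc n) \<sigma> = Suc (card S)"
    unfolding perm_fcyc_def orb(2) using fin orb(3) by simp
  show ?thesis
    unfolding exc fixed cyc fcyc perm_weight_def
    by (simp add: power_add power_mult_distrib mult_ac)
qed

text \<open>On a fixed piece the cycle of \<open>Suc n\<close> is the same for every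
  \<open>\<sigma>\<close>. Restricting to \<open>{1..n} - S\<close> deletes it, and composing with
  it restores it, so the piece is in bijection with all permutations of the complement.\<close>

lemma sum_Q_hat_part:
  assumes S: "S \<subseteq> {1..n}"
  shows "(\<Sum>\<sigma>\<in>Q_hat_part (Suc n) S. perm_weight x y q ({1..n} - S) \<sigma>)
    = A_poly (n - card S) x y q"
proof -
  let ?T = "{1..n} - S" and ?ws = "sorted_list_of_set S @ [Suc n]"
  let ?c = "cycle_of_list ?ws"
  have fin: "finite S"
    using S finite_subset by blast
  have T: "?T = {1..Suc n} - insert (Suc n) S"
    by auto
  have set_ws: "set ?ws = insert (Suc n) S"
    using fin by simp
  have "Suc n \<notin> S"
    using S by auto
  then have c: "is_cycle_word ?c ?ws"
    using fin by (intro is_cycle_word_cycle_of_list) auto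
  have c_perm: "?c permutes insert (Suc n) S"
    using cycle_permutes[of ?ws] unfolding set_ws .
  have c_T: "?c i = i" if "i \<in> ?T" for i
    using that by (intro permutes_not_in[OF c_perm]) auto
  have restrict: "perm_restrict \<sigma> ?T permutes ?T" if "\<sigma> \<in> Q_hat_part (Suc n) S" for \<sigma>
    unfolding T using that Q_hat_part_orbit(1)[OF that fin]
    by (intro perm_restrict_diff_cyclic) (auto simp: Q_hat_part_def)
  have off_T: "\<pi> i = i" if "\<pi> permutes ?T" "i \<in> insert (Suc n) S" for \<pi> i
    using that by (intro permutes_not_in[OF that(1)]) auto
  have "(\<Sum>\<sigma>\<in>Q_hat_part (Suc n) S. perm_weight x y q ?T \<sigma>)
      = (\<Sum>\<pi> | \<pi> permutes ?T. perm_weight x y q ?T \<pi>)"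
  proof (rule sum.reindex_bij_witness[where i = "\<lambda>\<pi>. ?c \<circ> \<pi>" and j = "\<lambda>\<sigma>. perm_restrict \<sigma> ?T"])
    fix \<sigma> assume \<sigma>: "\<sigma> \<in> Q_hat_part (Suc n) S"
    then have perm: "\<sigma> permutes {1..Suc n}" and word: "is_cycle_word \<sigma> ?ws"
      by (auto simp: Q_hat_part_def)
    have in_T: "\<sigma> i \<in> ?T" if "i \<in> ?T" for i
      using permutes_in_image[OF restrict[OF \<sigma>], of i] that by (simp add: perm_restrict_simps)
    show "perm_restrict \<sigma> ?T \<in> {\<pi>. \<pi> permutes ?T}"
      using restrict[OF \<sigma>] by simp
    \<comment> \<open>On \<open>?T\<close> the cycle \<open>?c\<close> is the identity; on the
      cycle, \<open>?c\<close> and \<open>\<sigma>\<close> follow the same word; elsewhere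
      everything is fixed.\<close>
    show "?c \<circ> perm_restrict \<sigma> ?T = \<sigma>"
    proof
      fix i
      consider "i \<in> ?T" | "i \<in> insert (Suc n) S" | "i \<notin> {1..Suc n}" "i \<notin> insert (Suc n) S"
        using T by blast
      then show "(?c \<circ> perm_restrict \<sigma> ?T) i = \<sigma> i"
      proof cases
        case 1
        then show ?thesis
          using c_T[OF in_T[OF 1]] by (simp add: perm_restrict_simps)
      next
        case 2
        then have "i \<notin> ?T" by auto
        then show ?thesis
          using is_cycle_word_agree[OF c word] 2 unfolding set_ws
          by (simp add: perm_restrict_simps)
      next
        case 3
        then have "i \<notin> ?T" by auto
        then show ?thesis
          using permutes_not_in[OF c_perm 3(2)] permutes_not_in[OF perm 3(1)]
          by (simp add: perm_restrict_simps)
      qed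
    qed
    show "perm_weight x y q ?T (perm_restrict \<sigma> ?T) = perm_weight x y q ?T \<sigma>"
      using in_T by (intro perm_weight_cong) (auto simp: perm_restrict_simps)
  next
    fix \<pi> assume "\<pi> \<in> {\<pi>. \<pi> permutes ?T}"
    then have \<pi>: "\<pi> permutes ?T" by simp
    have in_T: "\<pi> i \<in> ?T" if "i \<in> ?T" for i
      using permutes_in_image[OF \<pi>] that by simp
    show "perm_restrict (?c \<circ> \<pi>) ?T = \<pi>"
    proof
      fix i
      show "perm_restrict (?c \<circ> \<pi>) ?T i = \<pi> i"
      proof (cases "i \<in> ?T")
        case True
        then show ?thesis
          using c_T[OF in_T[OF True]] by (simp add: perm_restrict_simps)
      next
        case False
        then show ?thesis
          using permutes_not_in[OF \<pi> False] by (simp add: perm_restrict_simps)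
      qed
    qed
    have "?c permutes {1..Suc n}"
      using S by (intro permutes_subset[OF c_perm]) auto
    moreover have "\<pi> permutes {1..Suc n}"
      by (intro permutes_subset[OF \<pi>]) auto
    ultimately have "?c \<circ> \<pi> permutes {1..Suc n}"
      by (intro permutes_compose)
    \<comment> \<open>The letters of the word are fixed by \<open>\<pi>\<close>, so the composite
      follows the word exactly as \<open>?c\<close> does.\<close>
    moreover have "(?c \<circ> \<pi>) a = ?c a" if "a \<in> set ?ws" for a
      using that off_T[OF \<pi>] unfolding set_ws by simp
    then have "is_cycle_word (?c \<circ> \<pi>) ?ws"
      using c unfolding is_cycle_word_def by (metis nth_mem)
    ultimately show "?c \<circ> \<pi> \<in> Q_hat_part (Suc n) S"
      by (simp add: Q_hat_part_def)
  qed
  also have "\<dots> = A_poly (card ?T) x y q"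
    using perm_sum_eq_A_poly[of ?T x y q] by (simp add: perm_sum_def)
  also have "card ?T = n - card S"
    using S fin by (simp add: card_Diff_subset)
  finally show ?thesis .
qed

section \<open>Binomial convolution and the generating functions\<close>

lemma sum_Pow_card:
  fixes f :: "nat \<Rightarrow> 'b::semiring_1"
  assumes "finite A"
  shows "(\<Sum>S\<in>Pow A. f (card S)) = (\<Sum>k\<le>card A. of_nat (card A choose k) * f k)"
proof -
  have "(\<Sum>S\<in>Pow A. f (card S)) = (\<Sum>k\<le>card A. \<Sum>S | S \<in> Pow A \<and> card S = k. f (card S))"
    using assms by (intro sum.group[symmetric]) (auto intro: card_mono)
  also have "\<dots> = (\<Sum>k\<le>card A. of_nat (card A choose k) * f k)"
    by (intro sum.cong refl) (simp add: n_subsets[OF assms])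
  finally show ?thesis .
qed

lemma A_tilde_poly_eq:
  fixes x y q p :: "'a::field_char_0"
  shows "A_tilde_poly n x y q p = (\<Sum>k\<le>n. of_nat (n choose k) *
    ((x * p) ^ k * (if k = 0 then y else 1) * (p * q) * A_poly (n - k) x y q))"
proof -
  let ?w = "\<lambda>\<sigma>. x ^ perm_exc (Suc n) \<sigma> * y ^ perm_fix (Suc n) \<sigma> * q ^ perm_cyc (Suc n) \<sigma>
    * p ^ perm_fcyc (Suc n) \<sigma>"
  have "finite (Q_hat_part (Suc n) S)" for S
    by (rule finite_subset[OF _ finite_permutations[of "{1..Suc n}"]]) (auto simp: Q_hat_part_def)
  then have "A_tilde_poly n x y q p = (\<Sum>S\<in>Pow {1..n}. sum ?w (Q_hat_part (Suc n) S))"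
    unfolding A_tilde_poly_def Suc_eq_plus1[symmetric] Q_hat_eq_Union
    by (intro sum.UNION_disjoint) (auto simp: Q_hat_part_disjoint)
  \<comment> \<open>Writing \<open>S = {}\<close> as \<open>card S = 0\<close>, valid since
    \<open>S\<close> is finite, makes the summand depend on \<open>card S\<close> alone, so subsets
    can be grouped by size.\<close>
  also have "\<dots> = (\<Sum>S\<in>Pow {1..n}. (x * p) ^ card S * (if card S = 0 then y else 1) * (p * q)
      * A_poly (n - card S) x y q)"
  proof (rule sum.cong[OF refl])
    fix S assume "S \<in> Pow {1..n}"
    then have S: "S \<subseteq> {1..n}" and "finite S"
      using finite_subset by auto
    then have "sum ?w (Q_hat_part (Suc n) S) = (\<Sum>\<sigma>\<in>Q_hat_part (Suc n) S.
        (x * p) ^ card S * (if card S = 0 then y else 1) * (p * q)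
          * perm_weight x y q ({1..n} - S) \<sigma>)"
      by (intro sum.cong refl) (simp add: Q_hat_part_weight[OF S])
    also have "\<dots> = (x * p) ^ card S * (if card S = 0 then y else 1) * (p * q)
        * A_poly (n - card S) x y q"
      by (simp only: sum_distrib_left[symmetric] sum_Q_hat_part[OF S])
    finally show "sum ?w (Q_hat_part (Suc n) S) = \<dots>" .
  qed
  also have "\<dots> = (\<Sum>k\<le>n. of_nat (n choose k) *
      ((x * p) ^ k * (if k = 0 then y else 1) * (p * q) * A_poly (n - k) x y q))"
    using sum_Pow_card[of "{1..n}" "\<lambda>k. (x * p) ^ k * (if k = 0 then y else 1) * (p * q)
      * A_poly (n - k) x y q"] by simp
  finally show ?thesis .
qed

text \<open>The constant term 1 fits the general formula: the only permutation of the empty set is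
  the identity, of weight 1.\<close>

lemma A_series_nth: "fps_nth (A_series x y q) n = A_poly n x y q / fact n"
  by (cases n) (simp_all add: A_series_def A_poly_eq_perm_sum perm_sum_def perm_weight_def)

theorem theorem3p2:
  fixes x y q p :: "'a::field_char_0"
  shows "A_tilde_series x y q p
    = (fps_exp (x * p) + fps_const y - 1) * fps_const (p * q) * A_series x y q"
proof (rule fps_ext)
  fix n
  let ?E = "fps_exp (x * p) + fps_const y - 1"
  \<comment> \<open>At \<open>k = 0\<close> the 1 from the exponential cancels against -1 and leaves
    \<open>y\<close>; at \<open>k > 0\<close> only the exponential contributes.\<close>
  have E: "fps_nth (?E * fps_const (p * q)) k
      = (x * p) ^ k * (if k = 0 then y else 1) * (p * q) / fact k" for k
    by (cases k) (simp_all del: fact_Suc)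
  have "fps_nth (A_tilde_series x y q p) n
      = (\<Sum>k\<le>n. fps_nth (?E * fps_const (p * q)) k * fps_nth (A_series x y q) (n - k))"
    unfolding A_tilde_series_def fps_nth_Abs_fps A_tilde_poly_eq sum_divide_distrib E A_series_nth
    \<comment> \<open>Dividing \<open>n choose k\<close> by \<open>fact n\<close> leaves the
      reciprocals of \<open>fact k\<close> and \<open>fact (n - k)\<close>, one for each
      factor.\<close>
    by (intro sum.cong refl) (simp add: binomial_fact field_simps)
  also have "\<dots> = fps_nth (?E * fps_const (p * q) * A_series x y q) n"
    by (simp add: fps_mult_nth[of "?E * fps_const (p * q)"] atMost_atLeast0)
  finally show "fps_nth (A_tilde_series x y q p) n = fps_nth (?E * fps_const (p * q) * A_series x y q) n" .
qed

end
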